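(* For integers $n\ge 1$ and $0\le k\le n$, viewing $V^n_k$ as a $P_{n-1}$-module by restriction along the embedding $P_{n-1}\subseteq P_n$, there is an isomorphism of $P_{n-1}$-modules $$V^n_k\cong V^{n-1}_{k-1}\oplus V^{n-1}_k,$$ where the summand $V^{n-1}_{k-1}$ is dropped if $k=0$ and the summand $V^{n-1}_k$ is dropped if $k=n$. Consequently, in the Bratteli diagram of the tower $P_0\subseteq P_1\subseteq P_2\subseteq\cdots$, for $n\ge1$, $0\le k\le n$, $0\le \ell\le n-1$, there is an edge from $V^n_k$ to $V^{n-1}_\ell$ if and only if $\ell\in\{k-1,k\}$.
   Context: A rook diagram on $n$ is a graph on two rows of $n$ vertices, each row labeled $1,\dots,n$ from left to right, in which every edge joins a top vertex to a bottom vertex and each vertex lies on at most one edge. It corresponds to the $n\times n$ $0$-$1$ matrix having a $1$ in position $(i,j)$ exactly when top vertex $i$ is joined to bottom vertex $j$. The product $d_1d_2$ is the matrix product; equivalently, place $d_1$ above $d_2$, identify the bottom row of $d_1$ with the top row of $d_2$, and keep the edges obtained by composition. A rook diagram is planar if it can be drawn inside the rectangle formed by its vertices without edge crossings. $P_n$ denotes the monoid of planar rook diagrams on $n$, with $P_0=\{\emptyset\}$ the one-element monoid. $P_{n-1}$ is embedded in $P_n$ by adding to each diagram in $P_{n-1}$ an $n$th vertex at the right end of each row together with a vertical edge connecting these two new vertices. For $d\in P_n$, $\tau(d)$ and $\beta(d)$ are the sets of vertices in the top and bottom rows, respectively, that are incident to an edge. View $d$ as the bijection $\beta(d)\to\tau(d)$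 sending each bottom vertex to the top vertex it is joined to. For $S\subseteq\beta(d)$ put $d(S)=\{d(s): s\in S\}$. $V^n_k$ ($0\le k\le n$) is the complex vector space with basis $\{v_S : S\subseteq\{1,\dots,n\},\ |S|=k\}$, with $d\in P_n$ acting linearly by $d v_S = v_{d(S)}$ if $S\subseteq\beta(d)$ and $d v_S=0$ otherwise. The modules $V^n_k$, $0\le k\le n$, are the irreducible $P_n$-modules up to isomorphism. The Bratteli diagram of the tower is the graph whose vertices are the irreducible representations $V^n_k$ ($n\ge0$, $0\le k\le n$), with an edge from $V^n_k$ to $V^{n-1}_\ell$ if and only if $V^{n-1}_\ell$ appears as a summand when $V^n_k$ is viewed as a module for $P_{n-1}$. *)

theory Defs
  imports "HOL-Analysis.Fashoda_Theorem" "HOL-Algebra.Algebra"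
begin

section \<open>Modules over a monoid\<close>

record ('g, 'a, 'b) monoid_module = "('a, 'b) module" +
  act :: "'g \<Rightarrow> 'b \<Rightarrow> 'b"

locale monoid_module = G: monoid G + V: Module.module R V
  for G :: "('g, 'm) monoid_scheme"
    and R :: "('a, 'r) ring_scheme"
    and V :: "('g, 'a, 'b, 'v) monoid_module_scheme" +
  assumes act_closed:
      "\<lbrakk>g \<in> carrier G; x \<in> carrier V\<rbrakk> \<Longrightarrow> act V g x \<in> carrier V"
    and act_add:
      "\<lbrakk>g \<in> carrier G; x \<in> carrier V; y \<in> carrier V\<rbrakk> \<Longrightarrow>
        act V g (x \<oplus>\<^bsub>V\<^esub> y) = act V g x \<oplus>\<^bsub>V\<^esub> act V g y"
    and act_smult:
      "\<lbrakk>g \<in> carrier G; a \<in> carrier R; x \<in> carrier V\<rbrakk> \<Longrightarrow>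
        act V g (a \<odot>\<^bsub>V\<^esub> x) = a \<odot>\<^bsub>V\<^esub> act V g x"
    and act_one: "x \<in> carrier V \<Longrightarrow> act V \<one>\<^bsub>G\<^esub> x = x"
    and act_mult:
      "\<lbrakk>g \<in> carrier G; h \<in> carrier G; x \<in> carrier V\<rbrakk> \<Longrightarrow>
        act V (g \<otimes>\<^bsub>G\<^esub> h) x = act V g (act V h x)"

definition module_isomorphic ::
  "('g, 'm) monoid_scheme \<Rightarrow> ('a, 'r) ring_scheme \<Rightarrow>
   ('g, 'a, 'b, 'v) monoid_module_scheme \<Rightarrow> ('g, 'a, 'c, 'w) monoid_module_scheme \<Rightarrow> bool"
  where
  "module_isomorphic G R V W \<longleftrightarrow>
    (\<exists>\<phi>. bij_betw \<phi> (carrier V) (carrier W) \<and>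
      (\<forall>x\<in>carrier V. \<forall>y\<in>carrier V. \<phi> (x \<oplus>\<^bsub>V\<^esub> y) = \<phi> x \<oplus>\<^bsub>W\<^esub> \<phi> y) \<and>
      (\<forall>a\<in>carrier R. \<forall>x\<in>carrier V. \<phi> (a \<odot>\<^bsub>V\<^esub> x) = a \<odot>\<^bsub>W\<^esub> \<phi> x) \<and>
      (\<forall>g\<in>carrier G. \<forall>x\<in>carrier V. \<phi> (act V g x) = act W g (\<phi> x)))"

text \<open>
  The record fields \<open>mult\<close> and \<open>one\<close>, which the library's module record inherits from rings,
  play no role for modules and are left undefined here and below.
\<close>

definition direct_sum ::
  "('g, 'a, 'b) monoid_module \<Rightarrow> ('g, 'a, 'c) monoid_module \<Rightarrow> ('g, 'a, 'b \<times> 'c) monoid_module"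
  where
  "direct_sum V W =
    \<lparr>carrier = carrier V \<times> carrier W,
     monoid.mult = undefined, one = undefined,
     ring.zero = (\<zero>\<^bsub>V\<^esub>, \<zero>\<^bsub>W\<^esub>),
     add = (\<lambda>(x, y) (x', y'). (x \<oplus>\<^bsub>V\<^esub> x', y \<oplus>\<^bsub>W\<^esub> y')),
     smult = (\<lambda>a (x, y). (a \<odot>\<^bsub>V\<^esub> x, a \<odot>\<^bsub>W\<^esub> y)),
     act = (\<lambda>g (x, y). (act V g x, act W g y))\<rparr>"

definition restrict_along :: "('h \<Rightarrow> 'g) \<Rightarrow> ('g, 'a, 'b) monoid_module \<Rightarrow> ('h, 'a, 'b) monoid_module"
  where
  "restrict_along \<iota> V =
    \<lparr>carrier = carrier V,
     monoid.mult = monoid.mult V, one = one V,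
     ring.zero = ring.zero V, add = add V,
     smult = smult V,
     act = (\<lambda>h. act V (\<iota> h))\<rparr>"

definition invariant_submodule ::
  "('g, 'm) monoid_scheme \<Rightarrow> ('a, 'r) ring_scheme \<Rightarrow>
   ('g, 'a, 'b, 'v) monoid_module_scheme \<Rightarrow> 'b set \<Rightarrow> bool"
  where
  "invariant_submodule G R V U \<longleftrightarrow>
    submodule U R V \<and> (\<forall>g\<in>carrier G. \<forall>x\<in>U. act V g x \<in> U)"

definition is_summand ::
  "('g, 'm) monoid_scheme \<Rightarrow> ('a, 'r) ring_scheme \<Rightarrow>
   ('g, 'a, 'c, 'w) monoid_module_scheme \<Rightarrow> ('g, 'a, 'b, 'v) monoid_module_scheme \<Rightarrow> bool"
  where
  "is_summand G R W V \<longleftrightarrow>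
    (\<exists>U U'. invariant_submodule G R V U \<and> invariant_submodule G R V U' \<and>
      U \<inter> U' = {\<zero>\<^bsub>V\<^esub>} \<and> U <+>\<^bsub>V\<^esub> U' = carrier V \<and>
      module_isomorphic G R W (V\<lparr>carrier := U\<rparr>))"


section \<open>Planar rook diagrams\<close>

text \<open>
  A diagram is the set of its edges; \<open>(i, j)\<close> is the edge joining top vertex \<open>i\<close> to bottom
  vertex \<open>j\<close>. Stacking \<open>d\<^sub>1\<close> above \<open>d\<^sub>2\<close> is then relational composition \<open>d\<^sub>1 O d\<^sub>2\<close>.
\<close>

type_synonym diagram = "(nat \<times> nat) set"

definition rook_diagram :: "nat \<Rightarrow> diagram \<Rightarrow> bool" where
  "rook_diagram n d \<longleftrightarrow>
    d \<subseteq> {1..n} \<times> {1..n} \<and>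
    (\<forall>i j j'. (i, j) \<in> d \<and> (i, j') \<in> d \<longrightarrow> j = j') \<and>
    (\<forall>i i' j. (i, j) \<in> d \<and> (i', j) \<in> d \<longrightarrow> i = i')"

definition top_vertex :: "nat \<Rightarrow> real \<times> real" where
  "top_vertex i = (real i, 1)"

definition bottom_vertex :: "nat \<Rightarrow> real \<times> real" where
  "bottom_vertex j = (real j, 0)"

text \<open>
  Distinct edges of a rook diagram have no common endpoint, so that having no crossing means
  being disjoint.
\<close>

definition planar_drawing :: "nat \<Rightarrow> diagram \<Rightarrow> (nat \<times> nat \<Rightarrow> real \<Rightarrow> real \<times> real) \<Rightarrow> bool" where
  "planar_drawing n d \<gamma> \<longleftrightarrow>
    (\<forall>(i, j)\<in>d.
      arc (\<gamma> (i, j)) \<and>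
      pathstart (\<gamma> (i, j)) = top_vertex i \<and> pathfinish (\<gamma> (i, j)) = bottom_vertex j \<and>
      path_image (\<gamma> (i, j)) \<subseteq> {1..real n} \<times> {0..1} \<and>
      path_image (\<gamma> (i, j)) \<inter> (top_vertex ` {1..n} \<union> bottom_vertex ` {1..n})
        = {top_vertex i, bottom_vertex j}) \<and>
    (\<forall>e\<in>d. \<forall>e'\<in>d. e \<noteq> e' \<longrightarrow> path_image (\<gamma> e) \<inter> path_image (\<gamma> e') = {})"

definition planar :: "nat \<Rightarrow> diagram \<Rightarrow> bool" where
  "planar n d \<longleftrightarrow> (\<exists>\<gamma>. planar_drawing n d \<gamma>)"

definition planar_rook_monoid :: "nat \<Rightarrow> diagram monoid" where
  "planar_rook_monoid n =
    \<lparr>carrier = {d. rook_diagram n d \<and> planar n d}, monoid.mult = (O), one = Id_on {1..n}\<rparr>"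

text \<open>The embedding of \<open>planar_rook_monoid (n - 1)\<close> into \<open>planar_rook_monoid n\<close>, for \<open>n \<ge> 1\<close>.\<close>

definition embed_diagram :: "nat \<Rightarrow> diagram \<Rightarrow> diagram" where
  "embed_diagram n d = insert (n, n) d"

definition top_set :: "diagram \<Rightarrow> nat set" where
  "top_set d = {i. \<exists>j. (i, j) \<in> d}"

definition bottom_set :: "diagram \<Rightarrow> nat set" where
  "bottom_set d = {j. \<exists>i. (i, j) \<in> d}"

definition diagram_map :: "diagram \<Rightarrow> nat \<Rightarrow> nat" where
  "diagram_map d j = (THE i. (i, j) \<in> d)"


section \<open>The modules \<open>V\<^sup>n\<^sub>k\<close>\<close>

definition complex_field :: "complex ring" where
  "complex_field =
    \<lparr>carrier = UNIV, monoid.mult = (*), one = 1, ring.zero = 0, add = (+)\<rparr>"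

definition subsets_of_card :: "nat \<Rightarrow> nat \<Rightarrow> nat set set" where
  "subsets_of_card n k = {S. S \<subseteq> {1..n} \<and> card S = k}"

text \<open>
  A vector is the family of its coordinates with respect to the basis of all \<open>v\<^sub>S\<close>, extended by \<open>0\<close>
  to sets \<open>S\<close> that index no basis vector.
\<close>

definition basis_vector :: "nat set \<Rightarrow> nat set \<Rightarrow> complex" where
  "basis_vector S = (\<lambda>T. if T = S then 1 else 0)"

definition rook_action_on_basis :: "diagram \<Rightarrow> nat set \<Rightarrow> nat set \<Rightarrow> complex" where
  "rook_action_on_basis d S =
    (if S \<subseteq> bottom_set d then basis_vector (diagram_map d ` S) else (\<lambda>_. 0))"

definition rook_module :: "nat \<Rightarrow> nat \<Rightarrow> (diagram, complex, nat set \<Rightarrow> complex) monoid_module" where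
  "rook_module n k =
    \<lparr>carrier = {f. \<forall>S. S \<notin> subsets_of_card n k \<longrightarrow> f S = 0},
     monoid.mult = undefined, one = undefined,
     ring.zero = (\<lambda>_. 0),
     add = (\<lambda>f g S. f S + g S),
     smult = (\<lambda>a f S. a * f S),
     act = (\<lambda>d f T. \<Sum>S\<in>subsets_of_card n k. f S * rook_action_on_basis d S T)\<rparr>"

abbreviation restricted_rook_module ::
  "nat \<Rightarrow> nat \<Rightarrow> (diagram, complex, nat set \<Rightarrow> complex) monoid_module" where
  "restricted_rook_module n k \<equiv> restrict_along (embed_diagram n) (rook_module n k)"


section \<open>The Bratteli diagram\<close>

text \<open>The vertex \<open>V\<^sup>n\<^sub>k\<close> is represented by the pair \<open>(n, k)\<close>.\<close>

definition bratteli_vertices :: "(nat \<times> nat) set" where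
  "bratteli_vertices = {(n, k). k \<le> n}"

definition bratteli_edges :: "((nat \<times> nat) \<times> (nat \<times> nat)) set" where
  "bratteli_edges =
    {((n, k), (m, l)). (n, k) \<in> bratteli_vertices \<and> (m, l) \<in> bratteli_vertices \<and> n = m + 1 \<and>
      is_summand (planar_rook_monoid m) complex_field (rook_module m l) (restricted_rook_module n k)}"


section \<open>Well-definedness\<close>

lemma fashoda_prod:
  fixes f g :: "real \<Rightarrow> real \<times> real"
  assumes "path f" "path g"
    and "path_image f \<subseteq> {a..b} \<times> {c..d}" "path_image g \<subseteq> {a..b} \<times> {c..d}"
    and "fst (pathstart f) = a" "fst (pathfinish f) = b"
    and "snd (pathstart g) = c" "snd (pathfinish g) = d"
  obtains z where "z \<in> path_image f" "z \<in> path_image g"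
proof -
  define h :: "real \<times> real \<Rightarrow> real ^ 2" where "h = (\<lambda>p. \<chi> i. if i = 1 then fst p else snd p)"
  have h1: "h p $ 1 = fst p" and h2: "h p $ 2 = snd p" for p
    by (simp_all add: h_def)
  have cont: "continuous_on A h" for A
  proof -
    have "continuous_on A (\<lambda>p. if i = 1 then fst p else snd p)" for i :: 2
      by (cases "i = 1") (auto intro: continuous_on_fst continuous_on_snd)
    then show ?thesis unfolding h_def by (rule continuous_on_vec_lambda)
  qed
  have inj: "p = q" if "h p = h q" for p q
    using that h1[of p] h1[of q] h2[of p] h2[of q] by (simp add: prod_eq_iff)
  have paths: "path (h \<circ> f)" "path (h \<circ> g)"
    using assms(1,2) cont by (auto intro: path_continuous_image)
  have img: "h ` ({a..b} \<times> {c..d}) \<subseteq> cbox (h (a, c)) (h (b, d))"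
    by (auto simp: mem_box_cart forall_2 h1 h2)
  obtain z where "z \<in> path_image (h \<circ> f)" "z \<in> path_image (h \<circ> g)"
  proof (rule fashoda[of "h \<circ> f" "h \<circ> g" "h (a, c)" "h (b, d)"])
    show "path_image (h \<circ> f) \<subseteq> cbox (h (a, c)) (h (b, d))"
      "path_image (h \<circ> g) \<subseteq> cbox (h (a, c)) (h (b, d))"
      using image_mono[OF assms(3), of h] image_mono[OF assms(4), of h] img
      unfolding path_image_compose by (blast intro: order_trans)+
  qed (use paths assms in \<open>auto simp: pathstart_compose pathfinish_compose h1 h2\<close>)
  then obtain x y where "x \<in> path_image f" "y \<in> path_image g" "h x = h y"
    unfolding path_image_compose by (metis imageE)
  then show thesis
    using that inj by metis
qed

lemma vertical_segment:
  fixes x y z :: real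
  assumes "y \<le> z"
  shows "closed_segment (x, y) (x, z) \<subseteq> {x} \<times> {y..z}"
  using assms by (intro closed_segment_subset convex_Times) auto

lemma horizontal_segment:
  fixes x y z :: real
  assumes "y \<le> z"
  shows "closed_segment (y, x) (z, x) \<subseteq> {y..z} \<times> {x}"
  using assms by (intro closed_segment_subset convex_Times) auto

lemma planar_rook_order:
  assumes d: "d \<in> carrier (planar_rook_monoid n)"
    and e: "(i, j) \<in> d" "(i', j') \<in> d" "i < i'"
  shows "j < j'"
proof (rule ccontr)
  assume "\<not> j < j'"
  from d have rook: "rook_diagram n d" and "planar n d"
    by (simp_all add: planar_rook_monoid_def)
  have "j \<noteq> j'" using rook e unfolding rook_diagram_def by blast
  with \<open>\<not> j < j'\<close> have jj: "j' < j" by simp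
  have rng: "1 \<le> i" "i' \<le> n" "1 \<le> j'" "j \<le> n"
    using rook e unfolding rook_diagram_def by auto
  obtain \<gamma> where \<gamma>: "planar_drawing n d \<gamma>"
    using \<open>planar n d\<close> unfolding planar_def by blast
  define p where "p = \<gamma> (i, j)"
  define q where "q = \<gamma> (i', j')"
  have draw: "\<forall>(i, j)\<in>d.
      arc (\<gamma> (i, j)) \<and>
      pathstart (\<gamma> (i, j)) = top_vertex i \<and> pathfinish (\<gamma> (i, j)) = bottom_vertex j \<and>
      path_image (\<gamma> (i, j)) \<subseteq> {1..real n} \<times> {0..1}"
    using \<gamma> unfolding planar_drawing_def by blast
  have p: "path p" "pathstart p = (real i, 1)" "pathfinish p = (real j, 0)"
      "path_image p \<subseteq> {1..real n} \<times> {0..1}"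
    using bspec[OF draw e(1)] by (simp_all add: p_def top_vertex_def bottom_vertex_def arc_imp_path)
  have q: "path q" "pathstart q = (real i', 1)" "pathfinish q = (real j', 0)"
      "path_image q \<subseteq> {1..real n} \<times> {0..1}"
    using bspec[OF draw e(2)] by (simp_all add: q_def top_vertex_def bottom_vertex_def arc_imp_path)
  have disj: "path_image p \<inter> path_image q = {}"
  proof -
    have "\<forall>e\<in>d. \<forall>e'\<in>d. e \<noteq> e' \<longrightarrow> path_image (\<gamma> e) \<inter> path_image (\<gamma> e') = {}"
      using \<gamma> unfolding planar_drawing_def by (rule conjunct2)
    from bspec[OF bspec[OF this e(1)] e(2)] e(3) show ?thesis
      unfolding p_def q_def by simp
  qed
  define f where "f = linepath (0, 3/2) (real i, 3/2) +++ linepath (real i, 3/2) (real i, 1) +++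
    p +++ linepath (real j, 0) (real j, -1/2) +++ linepath (real j, -1/2) (real n + 1, -1/2)"
  define g where "g = linepath (real j', -1) (real j', 0) +++ reversepath q +++
    linepath (real i', 1) (real i', 2)"
  have "path_image f = closed_segment (0, 3/2) (real i, 3/2) \<union>
      closed_segment (real i, 3/2) (real i, 1) \<union> path_image p \<union>
      closed_segment (real j, 0) (real j, -1/2) \<union>
      closed_segment (real j, -1/2) (real n + 1, -1/2)"
    unfolding f_def using p by (simp add: path_image_join Un_assoc)
  moreover have "closed_segment (0, 3/2::real) (real i, 3/2) \<subseteq> {0..real i} \<times> {3/2}"
    by (rule horizontal_segment) simp
  moreover have "closed_segment (real i, 3/2::real) (real i, 1) \<subseteq> {real i} \<times> {1..3/2}"
    using vertical_segment[of 1 "3/2" "real i"] by (simp add: closed_segment_commute)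
  moreover have "closed_segment (real j, 0::real) (real j, -1/2) \<subseteq> {real j} \<times> {-1/2..0}"
    using vertical_segment[of "-1/2" 0 "real j"] by (simp add: closed_segment_commute)
  moreover have "closed_segment (real j, -1/2::real) (real n + 1, -1/2) \<subseteq> {real j..real n + 1} \<times> {-1/2}"
    using rng by (intro horizontal_segment) simp
  ultimately have imf: "path_image f \<subseteq> {0..real i} \<times> {3/2} \<union> {real i} \<times> {1..3/2} \<union> path_image p \<union>
      {real j} \<times> {-1/2..0} \<union> {real j..real n + 1} \<times> {-1/2}"
    by blast
  have "path_image g = closed_segment (real j', -1) (real j', 0) \<union> path_image q \<union>
      closed_segment (real i', 1) (real i', 2)"
    unfolding g_def using q by (simp add: path_image_join Un_assoc)
  moreover have "closed_segment (real j', -1::real) (real j', 0) \<subseteq> {real j'} \<times> {-1..0}"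
    by (rule vertical_segment) simp
  moreover have "closed_segment (real i', 1::real) (real i', 2) \<subseteq> {real i'} \<times> {1..2}"
    by (rule vertical_segment) simp
  ultimately have img: "path_image g \<subseteq> {real j'} \<times> {-1..0} \<union> path_image q \<union> {real i'} \<times> {1..2}"
    by blast
  obtain z where z: "z \<in> path_image f" "z \<in> path_image g"
  proof (rule fashoda_prod[of f g 0 "real n + 1" "-1" 2])
    show "path f" unfolding f_def using p by simp
    show "path g" unfolding g_def using q by simp
    show "path_image f \<subseteq> {0..real n + 1} \<times> {-1..2}"
    proof -
      have "{1..real n} \<times> {0..1} \<subseteq> {0..real n + 1} \<times> {-1..2::real}"
        by (intro Sigma_mono) auto
      with p(4) have "path_image p \<subseteq> {0..real n + 1} \<times> {-1..2}"
        by (rule order_trans)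
      with rng e jj show ?thesis
        by (intro order_trans[OF imf] Un_least Sigma_mono) auto
    qed
    show "path_image g \<subseteq> {0..real n + 1} \<times> {-1..2}"
    proof -
      have "{1..real n} \<times> {0..1} \<subseteq> {0..real n + 1} \<times> {-1..2::real}"
        by (intro Sigma_mono) auto
      with q(4) have "path_image q \<subseteq> {0..real n + 1} \<times> {-1..2}"
        by (rule order_trans)
      with rng e jj show ?thesis
        by (intro order_trans[OF img] Un_least Sigma_mono) auto
    qed
  qed (simp_all add: f_def g_def)
  have ends: "(real i, 1) \<in> path_image p" "(real j, 0) \<in> path_image p"
    "(real i', 1) \<in> path_image q" "(real j', 0) \<in> path_image q"
    using pathstart_in_path_image[of p] pathfinish_in_path_image[of p]
      pathstart_in_path_image[of q] pathfinish_in_path_image[of q] p q by simp_all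
  obtain x y where xy: "z = (x, y)" by (cases z)
  have F: "(0 \<le> x \<and> x \<le> real i \<and> y = 3/2) \<or> (x = real i \<and> 1 \<le> y \<and> y \<le> 3/2) \<or>
      z \<in> path_image p \<or> (x = real j \<and> -1/2 \<le> y \<and> y \<le> 0) \<or>
      (real j \<le> x \<and> y = -1/2)"
    using subsetD[OF imf z(1)] unfolding xy Un_iff mem_Times_iff by simp blast
  have G: "(x = real j' \<and> -1 \<le> y \<and> y \<le> 0) \<or> z \<in> path_image q \<or> (x = real i' \<and> 1 \<le> y)"
    using subsetD[OF img z(2)] unfolding xy Un_iff mem_Times_iff by simp blast
  have P: "z \<in> path_image p \<Longrightarrow> 0 \<le> y \<and> y \<le> 1" and Q: "z \<in> path_image q \<Longrightarrow> 0 \<le> y \<and> y \<le> 1"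
    using p(4) q(4) xy by auto
  have npq: "\<not> (z \<in> path_image p \<and> z \<in> path_image q)" using disj by blast
  have c1: "z \<in> path_image p" if "x = real i" "y = 1" using ends that xy by simp
  have c2: "z \<in> path_image p" if "x = real j" "y = 0" using ends that xy by simp
  have c3: "z \<in> path_image q" if "x = real i'" "y = 1" using ends that xy by simp
  have c4: "z \<in> path_image q" if "x = real j'" "y = 0" using ends that xy by simp
  have "real i < real i'" "real j' < real j" using e jj by simp_all
  note lt = this
  have "z \<notin> path_image p"
  proof
    assume zp: "z \<in> path_image p"
    then have "z \<notin> path_image q" using npq by blast
    with G consider "x = real j'" "y \<le> 0" | "x = real i'" "1 \<le> y" by blast
    then show False
    proof cases
      case 1
      then show False using P[OF zp] c4 \<open>z \<notin> path_image q\<close> by simp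
    next
      case 2
      then show False using P[OF zp] c3 \<open>z \<notin> path_image q\<close> by simp
    qed
  qed
  moreover have "z \<notin> path_image q"
  proof
    assume zq: "z \<in> path_image q"
    from F consider "y = 3/2" | "x = real i" "1 \<le> y" | "z \<in> path_image p" |
        "x = real j" "y \<le> 0" | "y = -1/2"
      by blast
    then show False
    proof cases
      case 2
      then show False using Q[OF zq] c1 npq zq by simp
    next
      case 4
      then show False using Q[OF zq] c2 npq zq by simp
    qed (use Q[OF zq] npq zq in auto)
  qed
  ultimately have F': "(x \<le> real i \<and> y = 3/2) \<or> (x = real i \<and> 1 \<le> y) \<or>
      (x = real j \<and> y \<le> 0) \<or> (real j \<le> x \<and> y = -1/2)"
    and G': "(x = real j' \<and> y \<le> 0) \<or> (x = real i' \<and> 1 \<le> y)"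
    using F G by blast+
  from G' show False
  proof
    assume "x = real j' \<and> y \<le> 0"
    with F' lt show False by auto
  next
    assume "x = real i' \<and> 1 \<le> y"
    with F' lt show False by auto
  qed
qed

lemma planarI:
  assumes rook: "rook_diagram n d"
    and ord: "\<And>i j i' j'. (i, j) \<in> d \<Longrightarrow> (i', j') \<in> d \<Longrightarrow> i < i' \<Longrightarrow> j < j'"
  shows "planar n d"
proof -
  define \<gamma> where "\<gamma> = (\<lambda>(i, j). linepath (top_vertex i) (bottom_vertex j))"
  have im: "path_image (\<gamma> (i, j)) =
      {((1 - t) * real i + t * real j, 1 - t) | t. 0 \<le> t \<and> t \<le> 1}" for i j
    by (auto simp: \<gamma>_def top_vertex_def bottom_vertex_def closed_segment_def)
  have box: "path_image (\<gamma> (i, j)) \<subseteq> {1..real n} \<times> {0..1}" if "(i, j) \<in> d" for i j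
  proof -
    have "1 \<le> real i" "real i \<le> real n" "1 \<le> real j" "real j \<le> real n"
      using rook that unfolding rook_diagram_def by auto
    then have *: "top_vertex i \<in> {1..real n} \<times> {0..1}" "bottom_vertex j \<in> {1..real n} \<times> {0..1}"
      by (simp_all add: top_vertex_def bottom_vertex_def)
    have "convex ({1..real n} \<times> {0..1::real})"
      by (intro convex_Times convex_real_interval)
    then show ?thesis
      using * by (simp add: \<gamma>_def closed_segment_subset)
  qed
  have ends: "path_image (\<gamma> (i, j)) \<inter> (top_vertex ` {1..n} \<union> bottom_vertex ` {1..n})
      = {top_vertex i, bottom_vertex j}" if "(i, j) \<in> d" for i j
  proof
    show "path_image (\<gamma> (i, j)) \<inter> (top_vertex ` {1..n} \<union> bottom_vertex ` {1..n})
        \<subseteq> {top_vertex i, bottom_vertex j}"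
      unfolding im by (auto simp: top_vertex_def bottom_vertex_def)
    show "{top_vertex i, bottom_vertex j} \<subseteq>
        path_image (\<gamma> (i, j)) \<inter> (top_vertex ` {1..n} \<union> bottom_vertex ` {1..n})"
      using that rook by (auto simp: \<gamma>_def rook_diagram_def)
  qed
  have disj: "path_image (\<gamma> e) \<inter> path_image (\<gamma> e') = {}"
    if "e \<in> d" "e' \<in> d" "fst e < fst e'" for e e'
  proof -
    obtain i j i' j' where e: "e = (i, j)" "e' = (i', j')" by (metis surj_pair)
    have lt: "real i < real i'" "real j < real j'" using that ord e by auto
    have "(1 - t) * real i + t * real j < (1 - t) * real i' + t * real j'"
      if "0 \<le> t" "t \<le> 1" for t
    proof (cases "t = 1")
      case False
      then have "(1 - t) * real i < (1 - t) * real i'" using that lt by simp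
      moreover have "t * real j \<le> t * real j'" using that lt by (simp add: mult_left_mono)
      ultimately show ?thesis by linarith
    qed (use lt in simp)
    then show ?thesis unfolding e im by fastforce
  qed
  have "planar_drawing n d \<gamma>"
    unfolding planar_drawing_def
  proof (intro conjI ballI impI)
    fix e assume e: "e \<in> d"
    obtain i j where ij: "e = (i, j)" by (cases e)
    have "arc (\<gamma> (i, j))"
      by (auto simp: \<gamma>_def top_vertex_def bottom_vertex_def intro!: arc_linepath)
    moreover have "pathstart (\<gamma> (i, j)) = top_vertex i" "pathfinish (\<gamma> (i, j)) = bottom_vertex j"
      by (simp_all add: \<gamma>_def)
    ultimately show "case e of (i, j) \<Rightarrow>
      arc (\<gamma> (i, j)) \<and>
      pathstart (\<gamma> (i, j)) = top_vertex i \<and> pathfinish (\<gamma> (i, j)) = bottom_vertex j \<and>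
      path_image (\<gamma> (i, j)) \<subseteq> {1..real n} \<times> {0..1} \<and>
      path_image (\<gamma> (i, j)) \<inter> (top_vertex ` {1..n} \<union> bottom_vertex ` {1..n})
        = {top_vertex i, bottom_vertex j}"
      using box[of i j] ends[of i j] e unfolding ij by simp
  next
    fix e e' assume *: "e \<in> d" "e' \<in> d" "e \<noteq> e'"
    then have "fst e \<noteq> fst e'"
      using rook unfolding rook_diagram_def by (metis prod.collapse)
    then show "path_image (\<gamma> e) \<inter> path_image (\<gamma> e') = {}"
      using disj[of e e'] disj[of e' e] * by (metis Int_commute linorder_neqE_nat)
  qed
  then show ?thesis unfolding planar_def by blast
qed

lemma planar_rook_iff:
  "d \<in> carrier (planar_rook_monoid n) \<longleftrightarrow>
    rook_diagram n d \<and> (\<forall>(i, j)\<in>d. \<forall>(i', j')\<in>d. i < i' \<longrightarrow> j < j')"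
proof
  assume d: "d \<in> carrier (planar_rook_monoid n)"
  then show "rook_diagram n d \<and> (\<forall>(i, j)\<in>d. \<forall>(i', j')\<in>d. i < i' \<longrightarrow> j < j')"
    using planar_rook_order[OF d] by (auto simp: planar_rook_monoid_def)
next
  assume "rook_diagram n d \<and> (\<forall>(i, j)\<in>d. \<forall>(i', j')\<in>d. i < i' \<longrightarrow> j < j')"
  then show "d \<in> carrier (planar_rook_monoid n)"
    using planarI[of n d] by (fastforce simp: planar_rook_monoid_def)
qed

lemma rook_diagram_comp:
  "rook_diagram n d \<Longrightarrow> rook_diagram n e \<Longrightarrow> rook_diagram n (d O e)"
  unfolding rook_diagram_def by blast

lemma planar_rook_comp:
  assumes "d \<in> carrier (planar_rook_monoid n)" "e \<in> carrier (planar_rook_monoid n)"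
  shows "d O e \<in> carrier (planar_rook_monoid n)"
  unfolding planar_rook_iff
proof (intro conjI ballI, safe)
  show "rook_diagram n (d O e)"
    using assms rook_diagram_comp by (simp add: planar_rook_monoid_def)
  fix i j i' j' m m'
  assume "(i, m) \<in> d" "(m, j) \<in> e" "(i', m') \<in> d" "(m', j') \<in> e" "i < i'"
  then show "j < j'"
    using planar_rook_order[OF assms(1)] planar_rook_order[OF assms(2)] by blast
qed

lemma planar_rook_Id: "Id_on {1..n} \<in> carrier (planar_rook_monoid n)"
  unfolding planar_rook_iff rook_diagram_def by auto

lemma monoid_planar_rook: "Group.monoid (planar_rook_monoid n)"
proof (rule Group.monoidI)
  fix d assume "d \<in> carrier (planar_rook_monoid n)"
  then have "d \<subseteq> {1..n} \<times> {1..n}"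
    by (simp add: planar_rook_monoid_def rook_diagram_def)
  then show "\<one>\<^bsub>planar_rook_monoid n\<^esub> \<otimes>\<^bsub>planar_rook_monoid n\<^esub> d = d"
    "d \<otimes>\<^bsub>planar_rook_monoid n\<^esub> \<one>\<^bsub>planar_rook_monoid n\<^esub> = d"
    by (auto simp: planar_rook_monoid_def)
qed (use planar_rook_comp planar_rook_Id in \<open>auto simp: planar_rook_monoid_def\<close>)

lemma embed_diagram_closed:
  assumes "1 \<le> n" "d \<in> carrier (planar_rook_monoid (n - 1))"
  shows "embed_diagram n d \<in> carrier (planar_rook_monoid n)"
proof -
  have rook: "rook_diagram (n - 1) d"
    using assms by (simp add: planar_rook_monoid_def)
  then have sub: "d \<subseteq> {1..n - 1} \<times> {1..n - 1}"
    by (simp add: rook_diagram_def)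
  have lt: "i < n \<and> j < n \<and> i \<noteq> n \<and> j \<noteq> n" if "(i, j) \<in> d" for i j
    using sub that assms(1) by fastforce
  show ?thesis
    unfolding planar_rook_iff
  proof (intro conjI)
    show "rook_diagram n (embed_diagram n d)"
      unfolding rook_diagram_def embed_diagram_def
    proof (intro conjI)
      show "insert (n, n) d \<subseteq> {1..n} \<times> {1..n}"
        using sub assms(1) by fastforce
      show "\<forall>i j j'. (i, j) \<in> insert (n, n) d \<and> (i, j') \<in> insert (n, n) d \<longrightarrow> j = j'"
        using rook lt unfolding rook_diagram_def by blast
      show "\<forall>i i' j. (i, j) \<in> insert (n, n) d \<and> (i', j) \<in> insert (n, n) d \<longrightarrow> i = i'"
        using rook lt unfolding rook_diagram_def by blast
    qed
    show "\<forall>(i, j)\<in>embed_diagram n d. \<forall>(i', j')\<in>embed_diagram n d. i < i' \<longrightarrow> j < j'"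
      using lt planar_rook_order[OF assms(2)]
      by (auto simp: embed_diagram_def dest: less_asym)
  qed
qed

lemma embed_diagram_hom:
  assumes "1 \<le> n"
  shows "embed_diagram n \<in> hom (planar_rook_monoid (n - 1)) (planar_rook_monoid n)"
    and "embed_diagram n (\<one>\<^bsub>planar_rook_monoid (n - 1)\<^esub>) = \<one>\<^bsub>planar_rook_monoid n\<^esub>"
    and "inj_on (embed_diagram n) (carrier (planar_rook_monoid (n - 1)))"
proof -
  have n: "(n, i) \<notin> d" "(i, n) \<notin> d" if "d \<in> carrier (planar_rook_monoid (n - 1))" for d i
    using that assms by (auto simp: planar_rook_monoid_def rook_diagram_def)
  show "embed_diagram n \<in> hom (planar_rook_monoid (n - 1)) (planar_rook_monoid n)"
    using assms n by (auto simp: hom_def embed_diagram_closed)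
      (auto simp: planar_rook_monoid_def embed_diagram_def)
  show "embed_diagram n (\<one>\<^bsub>planar_rook_monoid (n - 1)\<^esub>) = \<one>\<^bsub>planar_rook_monoid n\<^esub>"
    using assms by (auto simp: planar_rook_monoid_def embed_diagram_def Id_on_def)
  show "inj_on (embed_diagram n) (carrier (planar_rook_monoid (n - 1)))"
  proof (rule inj_onI)
    fix d e
    assume "d \<in> carrier (planar_rook_monoid (n - 1))" "e \<in> carrier (planar_rook_monoid (n - 1))"
      and eq: "embed_diagram n d = embed_diagram n e"
    then have "(n, n) \<notin> d" "(n, n) \<notin> e" using n by blast+
    with eq show "d = e" unfolding embed_diagram_def by (rule insert_ident[THEN iffD1, rotated 2])
  qed
qed


lemma diagram_map_eq:
  assumes "rook_diagram n d" "(i, j) \<in> d"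
  shows "diagram_map d j = i"
  unfolding diagram_map_def using assms unfolding rook_diagram_def by blast

lemma bij_betw_diagram_map:
  assumes "rook_diagram n d"
  shows "bij_betw (diagram_map d) (bottom_set d) (top_set d)"
proof (rule bij_betw_imageI)
  show "inj_on (diagram_map d) (bottom_set d)"
  proof (rule inj_onI)
    fix j j' assume "j \<in> bottom_set d" "j' \<in> bottom_set d" and eq: "diagram_map d j = diagram_map d j'"
    then obtain i i' where ij: "(i, j) \<in> d" "(i', j') \<in> d"
      unfolding bottom_set_def by blast
    with eq have "i = i'"
      using diagram_map_eq[OF assms] by metis
    with ij show "j = j'"
      using assms unfolding rook_diagram_def by blast
  qed
  show "diagram_map d ` bottom_set d = top_set d"
  proof
    show "diagram_map d ` bottom_set d \<subseteq> top_set d"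
      using diagram_map_eq[OF assms] unfolding bottom_set_def top_set_def by blast
    show "top_set d \<subseteq> diagram_map d ` bottom_set d"
    proof
      fix i assume "i \<in> top_set d"
      then obtain j where "(i, j) \<in> d" unfolding top_set_def by blast
      then show "i \<in> diagram_map d ` bottom_set d"
        using diagram_map_eq[OF assms] unfolding bottom_set_def by (intro image_eqI[of _ _ j]) auto
    qed
  qed
qed

lemma diagram_map_image:
  assumes d: "rook_diagram n d" and S: "S \<in> subsets_of_card n k" "S \<subseteq> bottom_set d"
  shows "diagram_map d ` S \<in> subsets_of_card n k"
proof -
  have b: "bij_betw (diagram_map d) (bottom_set d) (top_set d)"
    by (rule bij_betw_diagram_map[OF d])
  have "top_set d \<subseteq> {1..n}"
    using d unfolding rook_diagram_def top_set_def by auto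
  moreover have "diagram_map d ` S \<subseteq> top_set d"
    using b S(2) by (auto simp: bij_betw_def)
  moreover have "card (diagram_map d ` S) = card S"
    using b S(2) by (auto simp: bij_betw_def intro: card_image inj_on_subset)
  ultimately show ?thesis
    using S(1) unfolding subsets_of_card_def by blast
qed

lemma finite_subsets_of_card [simp]: "finite (subsets_of_card n k)"
  by (rule finite_subset[of _ "Pow {1..n}"]) (auto simp: subsets_of_card_def)

lemma act_basis_vector:
  assumes "S \<in> subsets_of_card n k"
  shows "act (rook_module n k) d (basis_vector S) =
    (if S \<subseteq> bottom_set d then basis_vector (diagram_map d ` S) else \<zero>\<^bsub>rook_module n k\<^esub>)"
proof -
  have "(\<Sum>U\<in>subsets_of_card n k. basis_vector S U * rook_action_on_basis d U T) =
      (\<Sum>U\<in>subsets_of_card n k. if U = S then rook_action_on_basis d U T else 0)" for T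
    by (rule sum.cong) (auto simp: basis_vector_def)
  then show ?thesis
    using assms by (simp add: rook_module_def rook_action_on_basis_def)
qed

lemma basis_expansion:
  assumes "f \<in> carrier (rook_module n k)"
  shows "f T = (\<Sum>S\<in>subsets_of_card n k. f S * basis_vector S T)"
proof -
  have "(\<Sum>S\<in>subsets_of_card n k. f S * basis_vector S T) =
      (\<Sum>S\<in>subsets_of_card n k. if S = T then f S else 0)"
    by (rule sum.cong) (auto simp: basis_vector_def)
  then show ?thesis
    using assms by (auto simp: rook_module_def)
qed

lemma rook_action_comp:
  assumes d: "rook_diagram n d" and e: "rook_diagram n e" and S: "S \<in> subsets_of_card n k"
  shows "(\<Sum>U\<in>subsets_of_card n k. rook_action_on_basis e S U * rook_action_on_basis d U T)
    = rook_action_on_basis (d O e) S T"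
proof -
  have map: "diagram_map (d O e) s = diagram_map d (diagram_map e s)"
    if "s \<in> bottom_set (d O e)" for s
    using that diagram_map_eq[OF d] diagram_map_eq[OF e]
      diagram_map_eq[OF rook_diagram_comp[OF d e]]
    by (force simp: bottom_set_def)
  have bot: "s \<in> bottom_set (d O e) \<longleftrightarrow> s \<in> bottom_set e \<and> diagram_map e s \<in> bottom_set d" for s
    using diagram_map_eq[OF e] unfolding bottom_set_def by blast
  show ?thesis
  proof (cases "S \<subseteq> bottom_set e")
    case True
    have "(\<Sum>U\<in>subsets_of_card n k. rook_action_on_basis e S U * rook_action_on_basis d U T) =
        (\<Sum>U\<in>subsets_of_card n k.
          if U = diagram_map e ` S then rook_action_on_basis d U T else 0)"
      using True by (intro sum.cong) (auto simp: rook_action_on_basis_def[of e] basis_vector_def)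
    also have "\<dots> = rook_action_on_basis d (diagram_map e ` S) T"
      using diagram_map_image[OF e S True] by simp
    also have "\<dots> = rook_action_on_basis (d O e) S T"
    proof (cases "S \<subseteq> bottom_set (d O e)")
      case True
      then have "diagram_map d ` diagram_map e ` S = diagram_map (d O e) ` S"
        using map by (force simp: image_iff)
      moreover have "diagram_map e ` S \<subseteq> bottom_set d"
        using True bot by blast
      ultimately show ?thesis
        using True by (simp add: rook_action_on_basis_def)
    next
      case False
      then have "\<not> diagram_map e ` S \<subseteq> bottom_set d"
        using True bot by blast
      with False show ?thesis by (simp add: rook_action_on_basis_def)
    qed
    finally show ?thesis .
  next
    case False
    then have "\<not> S \<subseteq> bottom_set (d O e)" using bot by blast
    with False show ?thesis by (simp add: rook_action_on_basis_def)
  qed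
qed

lemma field_complex_field: "Ring.field complex_field"
proof -
  have "\<exists>y. x + y = 0" for x :: complex
    by (rule exI[of _ "- x"]) simp
  moreover have "\<exists>y. x * y = 1" if "x \<noteq> 0" for x :: complex
    by (rule exI[of _ "inverse x"]) (use that in simp)
  ultimately show ?thesis
    unfolding complex_field_def
    by unfold_locales (auto simp: algebra_simps Units_def)
qed

lemma module_rook_module: "Module.module complex_field (rook_module n k)"
proof (rule Module.moduleI)
  show "Ring.cring complex_field"
    using field_complex_field by (simp add: Ring.field_def Ring.domain_def)
  show "abelian_group (rook_module n k)"
  proof (rule abelian_groupI)
    fix f assume "f \<in> carrier (rook_module n k)"
    then show "\<exists>g\<in>carrier (rook_module n k). g \<oplus>\<^bsub>rook_module n k\<^esub> f = \<zero>\<^bsub>rook_module n k\<^esub>"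
      by (intro bexI[of _ "\<lambda>S. - f S"]) (auto simp: rook_module_def)
  qed (auto simp: rook_module_def algebra_simps)
qed (auto simp: rook_module_def complex_field_def algebra_simps)

lemma monoid_module_rook_module:
  "monoid_module (planar_rook_monoid n) complex_field (rook_module n k)"
proof (intro monoid_module.intro monoid_module_axioms.intro monoid_planar_rook module_rook_module)
  fix d f assume d: "d \<in> carrier (planar_rook_monoid n)" and f: "f \<in> carrier (rook_module n k)"
  have rook: "rook_diagram n d" using d by (simp add: planar_rook_monoid_def)
  have "rook_action_on_basis d S T = 0"
    if "S \<in> subsets_of_card n k" "T \<notin> subsets_of_card n k" for S T
    using diagram_map_image[OF rook that(1)] that(2)
    by (auto simp: rook_action_on_basis_def basis_vector_def)
  then show "act (rook_module n k) d f \<in> carrier (rook_module n k)"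
    by (simp add: rook_module_def)
next
  fix f assume f: "f \<in> carrier (rook_module n k)"
  have "rook_action_on_basis (Id_on {1..n}) S = basis_vector S" if "S \<in> subsets_of_card n k" for S
  proof -
    have "bottom_set (Id_on {1..n}) = {1..n}" by (auto simp: bottom_set_def)
    moreover have "diagram_map (Id_on {1..n}) s = s" if "s \<in> {1..n}" for s
      using that by (intro diagram_map_eq[of n]) (auto simp: rook_diagram_def)
    ultimately show ?thesis
      using that by (auto simp: rook_action_on_basis_def subsets_of_card_def subset_iff)
  qed
  then show "act (rook_module n k) \<one>\<^bsub>planar_rook_monoid n\<^esub> f = f"
    using basis_expansion[OF f, symmetric] by (simp add: rook_module_def planar_rook_monoid_def)
next
  fix d e f
  assume "d \<in> carrier (planar_rook_monoid n)" "e \<in> carrier (planar_rook_monoid n)"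
    and f: "f \<in> carrier (rook_module n k)"
  then have rook: "rook_diagram n d" "rook_diagram n e"
    by (simp_all add: planar_rook_monoid_def)
  have "(\<Sum>S\<in>subsets_of_card n k. f S * rook_action_on_basis (d O e) S T) =
      (\<Sum>U\<in>subsets_of_card n k. (\<Sum>S\<in>subsets_of_card n k. f S * rook_action_on_basis e S U) *
        rook_action_on_basis d U T)" for T
  proof -
    have "(\<Sum>S\<in>subsets_of_card n k. f S * rook_action_on_basis (d O e) S T) =
        (\<Sum>S\<in>subsets_of_card n k. f S *
          (\<Sum>U\<in>subsets_of_card n k. rook_action_on_basis e S U * rook_action_on_basis d U T))"
      by (rule sum.cong) (simp_all add: rook_action_comp[OF rook])
    also have "\<dots> = (\<Sum>S\<in>subsets_of_card n k. \<Sum>U\<in>subsets_of_card n k.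
        f S * rook_action_on_basis e S U * rook_action_on_basis d U T)"
      by (simp add: sum_distrib_left mult.assoc)
    also have "\<dots> = (\<Sum>U\<in>subsets_of_card n k. \<Sum>S\<in>subsets_of_card n k.
        f S * rook_action_on_basis e S U * rook_action_on_basis d U T)"
      by (rule sum.swap)
    finally show ?thesis by (simp add: sum_distrib_right)
  qed
  then show "act (rook_module n k) (d \<otimes>\<^bsub>planar_rook_monoid n\<^esub> e) f =
      act (rook_module n k) d (act (rook_module n k) e f)"
    by (simp add: rook_module_def planar_rook_monoid_def)
next
  fix d f g
  show "act (rook_module n k) d (f \<oplus>\<^bsub>rook_module n k\<^esub> g) =
      act (rook_module n k) d f \<oplus>\<^bsub>rook_module n k\<^esub> act (rook_module n k) d g"
    by (simp add: rook_module_def distrib_right sum.distrib)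
next
  fix d a f
  show "act (rook_module n k) d (a \<odot>\<^bsub>rook_module n k\<^esub> f) =
      a \<odot>\<^bsub>rook_module n k\<^esub> act (rook_module n k) d f"
    by (simp add: rook_module_def sum_distrib_left mult.assoc)
qed

lemma module_restrict_along:
  assumes "Module.module R V"
  shows "Module.module R (restrict_along \<iota> V)"
proof -
  interpret Module.module R V by fact
  show ?thesis
  proof (rule Module.moduleI)
    show "abelian_group (restrict_along \<iota> V)"
    proof (rule abelian_groupI)
      fix x assume "x \<in> carrier (restrict_along \<iota> V)"
      then show "\<exists>y\<in>carrier (restrict_along \<iota> V).
          y \<oplus>\<^bsub>restrict_along \<iota> V\<^esub> x = \<zero>\<^bsub>restrict_along \<iota> V\<^esub>"
        by (auto simp: restrict_along_def intro!: bexI[of _ "\<ominus>\<^bsub>V\<^esub> x"] M.l_neg)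
    qed (auto simp: restrict_along_def M.a_assoc M.a_comm M.a_lcomm)
  qed (auto simp: restrict_along_def smult_l_distr smult_r_distr smult_assoc1 R.is_cring)
qed

lemma monoid_module_restrict_along:
  assumes V: "monoid_module G R V" and H: "Group.monoid H"
    and \<iota>: "\<iota> \<in> hom H G" "\<iota> \<one>\<^bsub>H\<^esub> = \<one>\<^bsub>G\<^esub>"
  shows "monoid_module H R (restrict_along \<iota> V)"
proof -
  interpret V: monoid_module G R V by fact
  have c: "\<iota> h \<in> carrier G" if "h \<in> carrier H" for h
    using \<iota> that by (auto simp: hom_def)
  have m: "\<iota> (g \<otimes>\<^bsub>H\<^esub> h) = \<iota> g \<otimes>\<^bsub>G\<^esub> \<iota> h" if "g \<in> carrier H" "h \<in> carrier H" for g h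
    using \<iota> that by (auto simp: hom_def)
  have "Module.module R (restrict_along \<iota> V)"
    by (rule module_restrict_along) (rule V.V.module_axioms)
  then show ?thesis
    by (intro monoid_module.intro monoid_module_axioms.intro H)
      (auto simp: restrict_along_def c m \<iota> V.act_closed V.act_add V.act_smult V.act_one V.act_mult)
qed

lemma module_direct_sum:
  assumes "Module.module R V" "Module.module R W"
  shows "Module.module R (direct_sum V W)"
proof -
  interpret V: Module.module R V by fact
  interpret W: Module.module R W by fact
  show ?thesis
  proof (rule Module.moduleI)
    show "abelian_group (direct_sum V W)"
    proof (rule abelian_groupI)
      fix x assume "x \<in> carrier (direct_sum V W)"
      then show "\<exists>y\<in>carrier (direct_sum V W). y \<oplus>\<^bsub>direct_sum V W\<^esub> x = \<zero>\<^bsub>direct_sum V W\<^esub>"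
        by (intro bexI[of _ "(\<ominus>\<^bsub>V\<^esub> fst x, \<ominus>\<^bsub>W\<^esub> snd x)"])
          (auto simp: direct_sum_def V.M.l_neg W.M.l_neg)
    qed (auto simp: direct_sum_def V.M.a_assoc V.M.a_comm V.M.a_lcomm
        W.M.a_assoc W.M.a_comm W.M.a_lcomm)
  qed (auto simp: direct_sum_def V.smult_l_distr V.smult_r_distr V.smult_assoc1
      W.smult_l_distr W.smult_r_distr W.smult_assoc1 V.R.is_cring)
qed

lemma monoid_module_direct_sum:
  assumes "monoid_module G R V" "monoid_module G R W"
  shows "monoid_module G R (direct_sum V W)"
proof -
  interpret V: monoid_module G R V by fact
  interpret W: monoid_module G R W by fact
  have "Module.module R (direct_sum V W)"
    by (rule module_direct_sum) (rule V.V.module_axioms W.V.module_axioms)+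
  then show ?thesis
    by (intro monoid_module.intro monoid_module_axioms.intro V.G.monoid_axioms)
      (auto simp: direct_sum_def V.act_closed V.act_add V.act_smult V.act_one V.act_mult
        W.act_closed W.act_add W.act_smult W.act_one W.act_mult)
qed

lemma monoid_module_restricted_rook_module:
  assumes "1 \<le> n"
  shows "monoid_module (planar_rook_monoid (n - 1)) complex_field (restricted_rook_module n k)"
  using assms
  by (intro monoid_module_restrict_along[OF monoid_module_rook_module] monoid_planar_rook
      embed_diagram_hom)

end

theory Submission
  imports Defs
begin

text \<open>
  An embedded diagram has the vertical edge at \<open>n\<close> and no other edge at \<open>n\<close>. It therefore maps
  sets containing \<open>n\<close> to sets containing \<open>n\<close>, and sets avoiding \<open>n\<close> to sets avoiding \<open>n\<close>,
  whenever it does not annihilate their basis vectors. So the basis of \<open>V\<^sup>n\<^sub>k\<close> splits into two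
  families, each spanning a submodule for the submonoid. Deleting \<open>n\<close> identifies the first span with \<open>V\<^sup>n\<^sup>-\<^sup>1\<^sub>k\<^sub>-\<^sub>1\<close>
  (\<open>rook_module_iso_with_last\<close>), and the second span is \<open>V\<^sup>n\<^sup>-\<^sup>1\<^sub>k\<close> on the nose
  (\<open>rook_module_iso_without_last\<close>). The first span vanishes for \<open>k = 0\<close> and the second for
  \<open>k = n\<close>. This gives the isomorphisms and the edges of the Bratteli diagram from \<open>k\<close> to
  \<open>k - 1\<close> and \<open>k\<close>.

  That there are no other edges (\<open>rook_module_summand_imp\<close>) is seen from the idempotents of the
  monoid. The diagram with vertical edges at the elements of \<open>A\<close> acts as
  the projection onto the span of those \<open>v\<^sub>S\<close> with \<open>S \<subseteq> A\<close>, and every homomorphism commutes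
  with these projections. The vector \<open>v\<^sub>S\<close> of \<open>V\<^sup>n\<^sup>-\<^sup>1\<^sub>l\<close> with \<open>S = {1..l}\<close> is fixed for
  \<open>A = S\<close> and killed when \<open>A\<close> does not contain \<open>S\<close>. Its image under an embedding into \<open>V\<^sup>n\<^sub>k\<close>
  behaves in the same way, hence involves only the basis vectors of \<open>S\<close> and \<open>S \<union> {n}\<close>; since it
  is nonzero, one of these two sets has \<open>k\<close> elements.
\<close>


section \<open>Isomorphisms and internal direct sums\<close>

text \<open>
  The definition of \<open>module_isomorphic\<close> makes no closure demands on either side. For the inverse map
  to respect the operations, \<open>W\<close> must be closed under them, which is why it has to be a module.
\<close>

lemma module_isomorphic_sym:
  assumes W: "monoid_module G R W" and iso: "module_isomorphic G R W V"
  shows "module_isomorphic G R V W"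
proof -
  interpret W: monoid_module G R W by fact
  obtain \<phi> where bij: "bij_betw \<phi> (carrier W) (carrier V)"
    and hom: "\<forall>x\<in>carrier W. \<forall>y\<in>carrier W. \<phi> (x \<oplus>\<^bsub>W\<^esub> y) = \<phi> x \<oplus>\<^bsub>V\<^esub> \<phi> y"
      "\<forall>a\<in>carrier R. \<forall>x\<in>carrier W. \<phi> (a \<odot>\<^bsub>W\<^esub> x) = a \<odot>\<^bsub>V\<^esub> \<phi> x"
      "\<forall>g\<in>carrier G. \<forall>x\<in>carrier W. \<phi> (act W g x) = act V g (\<phi> x)"
    using iso unfolding module_isomorphic_def by blast
  define \<psi> where "\<psi> = inv_into (carrier W) \<phi>"
  have \<psi>: "\<psi> x \<in> carrier W" "\<phi> (\<psi> x) = x" if "x \<in> carrier V" for x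
    using bij that by (auto simp: \<psi>_def bij_betw_def inv_into_into f_inv_into_f)
  have \<psi>_eq: "\<psi> x = y" if "y \<in> carrier W" "x = \<phi> y" for x y
    using bij that by (simp add: \<psi>_def bij_betw_inv_into_left)
  have "bij_betw \<psi> (carrier V) (carrier W)"
    unfolding \<psi>_def using bij by (rule bij_betw_inv_into)
  moreover have "\<psi> (x \<oplus>\<^bsub>V\<^esub> y) = \<psi> x \<oplus>\<^bsub>W\<^esub> \<psi> y" if "x \<in> carrier V" "y \<in> carrier V" for x y
    by (rule \<psi>_eq) (simp_all add: \<psi> that hom)
  moreover have "\<psi> (a \<odot>\<^bsub>V\<^esub> x) = a \<odot>\<^bsub>W\<^esub> \<psi> x" if "a \<in> carrier R" "x \<in> carrier V" for a x
    by (rule \<psi>_eq) (simp_all add: \<psi> that hom)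
  moreover have "\<psi> (act V g x) = act W g (\<psi> x)" if "g \<in> carrier G" "x \<in> carrier V" for g x
    by (rule \<psi>_eq) (simp_all add: \<psi> that hom W.act_closed)
  ultimately show ?thesis
    unfolding module_isomorphic_def by blast
qed

lemma direct_sum_isomorphic_internal:
  assumes V: "monoid_module G R V"
    and U: "invariant_submodule G R V U" and U': "invariant_submodule G R V U'"
    and int: "U \<inter> U' = {\<zero>\<^bsub>V\<^esub>}" and sum: "U <+>\<^bsub>V\<^esub> U' = carrier V"
    and W: "module_isomorphic G R W (V\<lparr>carrier := U\<rparr>)"
    and W': "module_isomorphic G R W' (V\<lparr>carrier := U'\<rparr>)"
  shows "module_isomorphic G R (direct_sum W W') V"
proof -
  interpret V: monoid_module G R V by fact
  have subm: "submodule U R V" "submodule U' R V"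
    using U U' by (simp_all add: invariant_submodule_def)
  note subE = V.V.submoduleE[OF subm(1)] and subE' = V.V.submoduleE[OF subm(2)]
  obtain \<phi> where \<phi>: "bij_betw \<phi> (carrier W) U"
      "\<forall>x\<in>carrier W. \<forall>y\<in>carrier W. \<phi> (x \<oplus>\<^bsub>W\<^esub> y) = \<phi> x \<oplus>\<^bsub>V\<^esub> \<phi> y"
      "\<forall>a\<in>carrier R. \<forall>x\<in>carrier W. \<phi> (a \<odot>\<^bsub>W\<^esub> x) = a \<odot>\<^bsub>V\<^esub> \<phi> x"
      "\<forall>g\<in>carrier G. \<forall>x\<in>carrier W. \<phi> (act W g x) = act V g (\<phi> x)"
    using W unfolding module_isomorphic_def by auto
  obtain \<phi>' where \<phi>': "bij_betw \<phi>' (carrier W') U'"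
      "\<forall>x\<in>carrier W'. \<forall>y\<in>carrier W'. \<phi>' (x \<oplus>\<^bsub>W'\<^esub> y) = \<phi>' x \<oplus>\<^bsub>V\<^esub> \<phi>' y"
      "\<forall>a\<in>carrier R. \<forall>x\<in>carrier W'. \<phi>' (a \<odot>\<^bsub>W'\<^esub> x) = a \<odot>\<^bsub>V\<^esub> \<phi>' x"
      "\<forall>g\<in>carrier G. \<forall>x\<in>carrier W'. \<phi>' (act W' g x) = act V g (\<phi>' x)"
    using W' unfolding module_isomorphic_def by auto
  have im: "\<phi> x \<in> U" "\<phi> x \<in> carrier V" if "x \<in> carrier W" for x
    using \<phi>(1) subE(1) that by (auto simp: bij_betw_def)
  have im': "\<phi>' x \<in> U'" "\<phi>' x \<in> carrier V" if "x \<in> carrier W'" for x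
    using \<phi>'(1) subE'(1) that by (auto simp: bij_betw_def)
  \<comment> \<open>The two differences in \<open>eq\<close> below agree and lie in \<open>U\<close> and \<open>U'\<close> respectively, so both are zero.\<close>
  have uniq: "u = v \<and> u' = v'"
    if "u \<in> U" "v \<in> U" "u' \<in> U'" "v' \<in> U'" "u \<oplus>\<^bsub>V\<^esub> u' = v \<oplus>\<^bsub>V\<^esub> v'" for u v u' v'
  proof -
    have c: "u \<in> carrier V" "v \<in> carrier V" "u' \<in> carrier V" "v' \<in> carrier V"
      using that subE(1) subE'(1) by auto
    have eq: "u \<oplus>\<^bsub>V\<^esub> \<ominus>\<^bsub>V\<^esub> v = v' \<oplus>\<^bsub>V\<^esub> \<ominus>\<^bsub>V\<^esub> u'"
    proof -
      have "u = v \<oplus>\<^bsub>V\<^esub> v' \<oplus>\<^bsub>V\<^esub> \<ominus>\<^bsub>V\<^esub> u'"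
        using c that(5) by (metis V.V.M.a_assoc V.V.M.a_inv_closed V.V.M.r_neg V.V.M.r_zero)
      then have "\<ominus>\<^bsub>V\<^esub> v \<oplus>\<^bsub>V\<^esub> u = \<ominus>\<^bsub>V\<^esub> v \<oplus>\<^bsub>V\<^esub> (v \<oplus>\<^bsub>V\<^esub> (v' \<oplus>\<^bsub>V\<^esub> \<ominus>\<^bsub>V\<^esub> u'))"
        using c by (simp add: V.V.M.a_assoc)
      then show ?thesis using c by (simp add: V.V.M.r_neg1 V.V.M.a_comm)
    qed
    have "u \<oplus>\<^bsub>V\<^esub> \<ominus>\<^bsub>V\<^esub> v \<in> U"
      using that subE by blast
    moreover have "v' \<oplus>\<^bsub>V\<^esub> \<ominus>\<^bsub>V\<^esub> u' \<in> U'"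
      using that subE' by blast
    ultimately have "u \<oplus>\<^bsub>V\<^esub> \<ominus>\<^bsub>V\<^esub> v = \<zero>\<^bsub>V\<^esub>"
      using eq int by auto
    then have "u = v" using c
      by (metis V.V.M.minus_equality V.V.M.minus_minus V.V.M.a_inv_closed)
    with that(5) c show ?thesis by simp
  qed
  define \<Phi> where "\<Phi> = (\<lambda>(x, y). \<phi> x \<oplus>\<^bsub>V\<^esub> \<phi>' y)"
  have "inj_on \<Phi> (carrier W \<times> carrier W')"
  proof (rule inj_onI, clarify)
    fix x y x2 y2
    assume *: "x \<in> carrier W" "y \<in> carrier W'" "x2 \<in> carrier W" "y2 \<in> carrier W'"
      and eq: "\<Phi> (x, y) = \<Phi> (x2, y2)"
    have "\<phi> x = \<phi> x2 \<and> \<phi>' y = \<phi>' y2"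
      by (rule uniq) (use * eq im im' in \<open>auto simp: \<Phi>_def\<close>)
    with * show "x = x2 \<and> y = y2"
      using \<phi>(1) \<phi>'(1) by (auto simp: bij_betw_def inj_on_def)
  qed
  moreover have "\<Phi> ` (carrier W \<times> carrier W') = carrier V"
  proof -
    have "carrier V = (\<Union>x\<in>carrier W. \<Union>y\<in>carrier W'. {\<phi> x \<oplus>\<^bsub>V\<^esub> \<phi>' y})"
      using \<phi>(1) \<phi>'(1) unfolding sum[symmetric] set_add_def' bij_betw_def by auto
    then show ?thesis by (auto simp: \<Phi>_def)
  qed
  ultimately have "bij_betw \<Phi> (carrier (direct_sum W W')) (carrier V)"
    by (simp add: bij_betw_def direct_sum_def)
  moreover have "\<forall>x\<in>carrier (direct_sum W W'). \<forall>y\<in>carrier (direct_sum W W').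
      \<Phi> (x \<oplus>\<^bsub>direct_sum W W'\<^esub> y) = \<Phi> x \<oplus>\<^bsub>V\<^esub> \<Phi> y"
    using im im' \<phi>(2) \<phi>'(2) by (auto simp: direct_sum_def \<Phi>_def V.V.M.a_ac)
  moreover have "\<forall>a\<in>carrier R. \<forall>x\<in>carrier (direct_sum W W').
      \<Phi> (a \<odot>\<^bsub>direct_sum W W'\<^esub> x) = a \<odot>\<^bsub>V\<^esub> \<Phi> x"
    using im im' \<phi>(3) \<phi>'(3) by (auto simp: direct_sum_def \<Phi>_def V.V.smult_r_distr)
  moreover have "\<forall>g\<in>carrier G. \<forall>x\<in>carrier (direct_sum W W').
      \<Phi> (act (direct_sum W W') g x) = act V g (\<Phi> x)"
    using im im' \<phi>(4) \<phi>'(4) by (auto simp: direct_sum_def \<Phi>_def V.act_add)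
  ultimately show ?thesis
    unfolding module_isomorphic_def by (intro exI[of _ \<Phi>] conjI)
qed


section \<open>The action in coordinates\<close>

text \<open>
  At most one basis vector is sent to \<open>v\<^sub>T\<close>: the edges of \<open>d\<close> can be followed backwards, from
  \<open>T\<close> down to the bottom row. So the sum defining the action has at most one nonzero term, and
  equivariance of a coordinatewise map becomes a statement about images of sets under \<open>d\<close>.
\<close>

lemma act_rook_module_apply:
  assumes d: "rook_diagram n d" and f: "f \<in> carrier (rook_module n k)"
  shows "act (rook_module n k) d f T = (if T \<subseteq> Domain d then f (d `` T) else 0)"
proof -
  have iff: "S \<subseteq> bottom_set d \<and> T = diagram_map d ` S \<longleftrightarrow> T \<subseteq> Domain d \<and> S = d `` T" for S
  proof
    assume S: "S \<subseteq> bottom_set d \<and> T = diagram_map d ` S"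
    then have e: "(diagram_map d s, s) \<in> d" if "s \<in> S" for s
      using that diagram_map_eq[OF d] by (force simp: bottom_set_def)
    then have "T \<subseteq> Domain d" using S by blast
    moreover have "S = d `` T"
    proof
      show "S \<subseteq> d `` T" using S e by blast
      show "d `` T \<subseteq> S"
      proof
        fix j assume "j \<in> d `` T"
        then obtain s where "s \<in> S" "(diagram_map d s, j) \<in> d" using S by blast
        with e[of s] d show "j \<in> S" unfolding rook_diagram_def by metis
      qed
    qed
    ultimately show "T \<subseteq> Domain d \<and> S = d `` T" ..
  next
    assume T: "T \<subseteq> Domain d \<and> S = d `` T"
    then have "S \<subseteq> bottom_set d" by (auto simp: bottom_set_def)
    moreover have "T = diagram_map d ` S"
      using T diagram_map_eq[OF d] by (force simp: image_iff)
    ultimately show "S \<subseteq> bottom_set d \<and> T = diagram_map d ` S" ..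
  qed
  have "rook_action_on_basis d S T = (if T \<subseteq> Domain d \<and> S = d `` T then 1 else 0)" for S
    unfolding iff[symmetric] by (simp add: rook_action_on_basis_def basis_vector_def)
  then have *: "f S * rook_action_on_basis d S T =
      (if S = d `` T then (if T \<subseteq> Domain d then f S else 0) else 0)" for S
    by simp
  have "act (rook_module n k) d f T = (\<Sum>S\<in>subsets_of_card n k. f S * rook_action_on_basis d S T)"
    by (simp add: rook_module_def)
  also have "\<dots> =
      (\<Sum>S\<in>subsets_of_card n k. if S = d `` T then (if T \<subseteq> Domain d then f S else 0) else 0)"
    by (simp only: *)
  also have "\<dots> = (if T \<subseteq> Domain d then f (d `` T) else 0)"
    using f by (simp add: rook_module_def)
  finally show ?thesis .
qed

text \<open>
  The vertical edge at \<open>n\<close> carries \<open>n\<close> along, so on sets with and without \<open>n\<close> the embedded diagram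
  acts by the same rule as \<open>d\<close> itself. All equivariance statements below rest on this.
\<close>

lemma restricted_act_apply:
  assumes n: "1 \<le> n" and d: "d \<in> carrier (planar_rook_monoid (n - 1))"
    and f: "f \<in> carrier (rook_module n k)" and S: "n \<notin> S"
  shows "act (restricted_rook_module n k) d f S = (if S \<subseteq> Domain d then f (d `` S) else 0)"
    and "act (restricted_rook_module n k) d f (insert n S) =
      (if S \<subseteq> Domain d then f (insert n (d `` S)) else 0)"
proof -
  have rook: "rook_diagram n (embed_diagram n d)"
    using embed_diagram_closed[OF n d] by (simp add: planar_rook_monoid_def)
  have "(n, j) \<notin> d" for j
    using d n by (auto simp: planar_rook_monoid_def rook_diagram_def)
  then have im: "embed_diagram n d `` S = d `` S"
      "embed_diagram n d `` insert n S = insert n (d `` S)"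
    and dom: "S \<subseteq> Domain (embed_diagram n d) \<longleftrightarrow> S \<subseteq> Domain d"
      "insert n S \<subseteq> Domain (embed_diagram n d) \<longleftrightarrow> S \<subseteq> Domain d"
    using S by (auto simp: embed_diagram_def)
  show "act (restricted_rook_module n k) d f S = (if S \<subseteq> Domain d then f (d `` S) else 0)"
    "act (restricted_rook_module n k) d f (insert n S) =
      (if S \<subseteq> Domain d then f (insert n (d `` S)) else 0)"
    using act_rook_module_apply[OF rook f] by (simp_all add: restrict_along_def im dom del: insert_subset)
qed

lemma planar_rook_bounds:
  assumes "d \<in> carrier (planar_rook_monoid m)"
  shows "Domain d \<subseteq> {1..m}" "d `` S \<subseteq> {1..m}"
  using assms by (auto simp: planar_rook_monoid_def rook_diagram_def)


section \<open>Splitting off the last vertex\<close>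

definition with_last :: "nat \<Rightarrow> nat \<Rightarrow> (nat set \<Rightarrow> complex) set" where
  "with_last n k = {f \<in> carrier (rook_module n k). \<forall>T. n \<notin> T \<longrightarrow> f T = 0}"

definition without_last :: "nat \<Rightarrow> nat \<Rightarrow> (nat set \<Rightarrow> complex) set" where
  "without_last n k = {f \<in> carrier (rook_module n k). \<forall>T. n \<in> T \<longrightarrow> f T = 0}"

lemma rook_module_simps:
  "f \<in> carrier (rook_module n k) \<longleftrightarrow> (\<forall>S. S \<notin> subsets_of_card n k \<longrightarrow> f S = 0)"
  "\<zero>\<^bsub>rook_module n k\<^esub> = (\<lambda>_. 0)"
  "f \<oplus>\<^bsub>rook_module n k\<^esub> g = (\<lambda>S. f S + g S)"
  "a \<odot>\<^bsub>rook_module n k\<^esub> f = (\<lambda>S. a * f S)"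
  by (simp_all add: rook_module_def)

lemma restrict_along_simps:
  "carrier (restrict_along \<iota> V) = carrier V"
  "\<zero>\<^bsub>restrict_along \<iota> V\<^esub> = \<zero>\<^bsub>V\<^esub>"
  "x \<oplus>\<^bsub>restrict_along \<iota> V\<^esub> y = x \<oplus>\<^bsub>V\<^esub> y"
  "a \<odot>\<^bsub>restrict_along \<iota> V\<^esub> x = a \<odot>\<^bsub>V\<^esub> x"
  by (simp_all add: restrict_along_def)

lemma a_inv_restricted_rook_module:
  assumes n: "1 \<le> n" and f: "f \<in> carrier (rook_module n k)"
  shows "\<ominus>\<^bsub>restricted_rook_module n k\<^esub> f = (\<lambda>S. - f S)"
proof -
  interpret V: monoid_module "planar_rook_monoid (n - 1)" complex_field "restricted_rook_module n k"
    using n by (rule monoid_module_restricted_rook_module)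
  show ?thesis
    by (rule V.V.M.minus_equality) (use f in \<open>auto simp: restrict_along_simps rook_module_simps\<close>)
qed

lemma invariant_with_last:
  assumes n: "1 \<le> n"
  shows "invariant_submodule (planar_rook_monoid (n - 1)) complex_field
    (restricted_rook_module n k) (with_last n k)"
  unfolding invariant_submodule_def
proof (intro conjI ballI)
  interpret V: monoid_module "planar_rook_monoid (n - 1)" complex_field "restricted_rook_module n k"
    using n by (rule monoid_module_restricted_rook_module)
  show "submodule (with_last n k) complex_field (restricted_rook_module n k)"
    by (rule V.V.submoduleI)
      (auto simp: with_last_def a_inv_restricted_rook_module[OF n] restrict_along_simps
        rook_module_simps)
  fix d f assume d: "d \<in> carrier (planar_rook_monoid (n - 1))" and f: "f \<in> with_last n k"
  have fc: "f \<in> carrier (rook_module n k)" using f by (simp add: with_last_def)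
  have "n \<notin> d `` S" for S
    using planar_rook_bounds(2)[OF d, of S] n by auto
  then have "act (restricted_rook_module n k) d f T = 0" if "n \<notin> T" for T
    using restricted_act_apply(1)[OF n d fc that] f by (simp add: with_last_def)
  moreover have "act (restricted_rook_module n k) d f \<in> carrier (rook_module n k)"
    using V.act_closed[OF d] fc by (simp add: restrict_along_simps)
  ultimately show "act (restricted_rook_module n k) d f \<in> with_last n k"
    by (simp add: with_last_def)
qed

lemma invariant_without_last:
  assumes n: "1 \<le> n"
  shows "invariant_submodule (planar_rook_monoid (n - 1)) complex_field
    (restricted_rook_module n k) (without_last n k)"
  unfolding invariant_submodule_def
proof (intro conjI ballI)
  interpret V: monoid_module "planar_rook_monoid (n - 1)" complex_field "restricted_rook_module n k"
    using n by (rule monoid_module_restricted_rook_module)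
  show "submodule (without_last n k) complex_field (restricted_rook_module n k)"
    by (rule V.V.submoduleI)
      (auto simp: without_last_def a_inv_restricted_rook_module[OF n] restrict_along_simps
        rook_module_simps)
  fix d f assume d: "d \<in> carrier (planar_rook_monoid (n - 1))" and f: "f \<in> without_last n k"
  have fc: "f \<in> carrier (rook_module n k)" using f by (simp add: without_last_def)
  have "act (restricted_rook_module n k) d f T = 0" if "n \<in> T" for T
    using restricted_act_apply(2)[OF n d fc, of "T - {n}"] f that
    by (simp add: without_last_def insert_absorb)
  moreover have "act (restricted_rook_module n k) d f \<in> carrier (rook_module n k)"
    using V.act_closed[OF d] fc by (simp add: restrict_along_simps)
  ultimately show "act (restricted_rook_module n k) d f \<in> without_last n k"
    by (simp add: without_last_def)
qed

lemma with_last_Int_without_last: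
  "with_last n k \<inter> without_last n k = {\<zero>\<^bsub>restricted_rook_module n k\<^esub>}"
proof -
  have "f = (\<lambda>_. 0)" if "f \<in> with_last n k" "f \<in> without_last n k" for f
  proof
    fix T show "f T = 0"
      using that by (cases "n \<in> T") (auto simp: with_last_def without_last_def)
  qed
  then show ?thesis
    by (auto simp: with_last_def without_last_def restrict_along_simps rook_module_simps)
qed

lemma with_last_add_without_last:
  "with_last n k <+>\<^bsub>restricted_rook_module n k\<^esub> without_last n k
    = carrier (restricted_rook_module n k)"
proof
  show "with_last n k <+>\<^bsub>restricted_rook_module n k\<^esub> without_last n k
      \<subseteq> carrier (restricted_rook_module n k)"
    by (auto simp: set_add_def' with_last_def without_last_def restrict_along_simps
        rook_module_simps)
  show "carrier (restricted_rook_module n k)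
      \<subseteq> with_last n k <+>\<^bsub>restricted_rook_module n k\<^esub> without_last n k"
  proof
    fix f assume f: "f \<in> carrier (restricted_rook_module n k)"
    have "(\<lambda>T. if n \<in> T then f T else 0) \<in> with_last n k"
      "(\<lambda>T. if n \<in> T then 0 else f T) \<in> without_last n k"
      using f by (auto simp: with_last_def without_last_def restrict_along_simps rook_module_simps)
    moreover have "f = (\<lambda>T. if n \<in> T then f T else 0)
        \<oplus>\<^bsub>restricted_rook_module n k\<^esub> (\<lambda>T. if n \<in> T then 0 else f T)"
      by (auto simp: restrict_along_simps rook_module_simps)
    ultimately show "f \<in> with_last n k <+>\<^bsub>restricted_rook_module n k\<^esub> without_last n k"
      unfolding set_add_def' by blast
  qed
qed

lemma subsets_of_card_without_last:
  assumes "1 \<le> n" "n \<notin> S"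
  shows "S \<in> subsets_of_card n k \<longleftrightarrow> S \<in> subsets_of_card (n - 1) k"
proof -
  have *: "{1..n} = insert n {1..n - 1}" using assms by auto
  have "S \<subseteq> {1..n} \<longleftrightarrow> S \<subseteq> {1..n - 1}"
    unfolding * using assms(2) by blast
  then show ?thesis by (simp add: subsets_of_card_def)
qed

lemma subsets_of_card_with_last:
  assumes "1 \<le> n" "1 \<le> k" "n \<notin> S"
  shows "insert n S \<in> subsets_of_card n k \<longleftrightarrow> S \<in> subsets_of_card (n - 1) (k - 1)"
proof -
  have *: "{1..n} = insert n {1..n - 1}" using assms by auto
  have "insert n S \<subseteq> {1..n} \<longleftrightarrow> S \<subseteq> {1..n - 1}"
    unfolding * using assms(3) by blast
  moreover have "card (insert n S) = k \<longleftrightarrow> card S = k - 1" if "S \<subseteq> {1..n - 1}"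
    using finite_subset[OF that] assms by auto
  ultimately show ?thesis
    unfolding subsets_of_card_def by blast
qed

lemma last_notin_subsets_of_card:
  assumes "1 \<le> n" "S \<in> subsets_of_card (n - 1) l"
  shows "n \<notin> S"
proof
  assume "n \<in> S"
  with assms(2) have "n \<in> {1..n - 1}" unfolding subsets_of_card_def by blast
  with assms(1) show False by simp
qed

text \<open>
  Vectors are families indexed by all sets of natural numbers, extended by \<open>0\<close>, so this is an
  equality of sets and not merely an isomorphism.
\<close>

lemma without_last_eq:
  assumes n: "1 \<le> n"
  shows "without_last n k = carrier (rook_module (n - 1) k)"
proof -
  have "S \<in> subsets_of_card (n - 1) k \<longleftrightarrow> S \<in> subsets_of_card n k \<and> n \<notin> S" for S
    using subsets_of_card_without_last[OF n] last_notin_subsets_of_card[OF n] by blast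
  then have mem: "S \<notin> subsets_of_card (n - 1) k \<longleftrightarrow> S \<notin> subsets_of_card n k \<or> n \<in> S" for S
    by simp
  show ?thesis
    unfolding without_last_def rook_module_simps set_eq_iff mem_Collect_eq mem by metis
qed

lemma rook_module_iso_without_last:
  assumes n: "1 \<le> n"
  shows "module_isomorphic (planar_rook_monoid (n - 1)) complex_field (rook_module (n - 1) k)
    ((restricted_rook_module n k)\<lparr>carrier := without_last n k\<rparr>)"
  unfolding module_isomorphic_def
proof (intro exI[of _ "\<lambda>f. f"] conjI ballI)
  show "bij_betw (\<lambda>f. f) (carrier (rook_module (n - 1) k))
      (carrier ((restricted_rook_module n k)\<lparr>carrier := without_last n k\<rparr>))"
    using without_last_eq[OF n] by (simp add: bij_betw_def)
  fix d f assume d: "d \<in> carrier (planar_rook_monoid (n - 1))"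
    and f: "f \<in> carrier (rook_module (n - 1) k)"
  have rook: "rook_diagram (n - 1) d"
    using d by (simp add: planar_rook_monoid_def)
  have fn: "f \<in> without_last n k"
    using f without_last_eq[OF n] by simp
  then have fc: "f \<in> carrier (rook_module n k)"
    by (simp add: without_last_def)
  have "act (rook_module (n - 1) k) d f T = act (restricted_rook_module n k) d f T" for T
  proof (cases "n \<in> T")
    case True
    moreover have "\<not> T \<subseteq> Domain d"
      using True planar_rook_bounds(1)[OF d] n by fastforce
    moreover have "act (restricted_rook_module n k) d f \<in> without_last n k"
      using invariant_without_last[OF n] d fn by (simp add: invariant_submodule_def)
    ultimately show ?thesis
      unfolding act_rook_module_apply[OF rook f] by (simp add: without_last_def)
  next
    case False
    then show ?thesis
      unfolding act_rook_module_apply[OF rook f] by (simp add: restricted_act_apply(1)[OF n d fc])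
  qed
  then show "act (rook_module (n - 1) k) d f =
      act ((restricted_rook_module n k)\<lparr>carrier := without_last n k\<rparr>) d f"
    by auto
qed (simp_all add: restrict_along_simps rook_module_simps)

lemma rook_module_iso_with_last:
  assumes n: "1 \<le> n" and k: "1 \<le> k"
  shows "module_isomorphic (planar_rook_monoid (n - 1)) complex_field (rook_module (n - 1) (k - 1))
    ((restricted_rook_module n k)\<lparr>carrier := with_last n k\<rparr>)"
proof -
  define \<phi> :: "(nat set \<Rightarrow> complex) \<Rightarrow> nat set \<Rightarrow> complex"
    where "\<phi> g = (\<lambda>T. if n \<in> T then g (T - {n}) else 0)" for g
  have mem: "T \<in> subsets_of_card n k \<longleftrightarrow> T - {n} \<in> subsets_of_card (n - 1) (k - 1)"
    if "n \<in> T" for T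
    using subsets_of_card_with_last[OF n k, of "T - {n}"] that by (simp add: insert_absorb)
  have \<phi>_in: "\<phi> g \<in> with_last n k" if "g \<in> carrier (rook_module (n - 1) (k - 1))" for g
    using that mem by (auto simp: \<phi>_def with_last_def rook_module_simps)
  have "bij_betw \<phi> (carrier (rook_module (n - 1) (k - 1))) (with_last n k)"
  proof (rule bij_betw_byWitness[where f' = "\<lambda>f S. if n \<in> S then 0 else f (insert n S)"])
    show "\<forall>g\<in>carrier (rook_module (n - 1) (k - 1)).
        (\<lambda>S. if n \<in> S then 0 else \<phi> g (insert n S)) = g"
      using last_notin_subsets_of_card[OF n] by (fastforce simp: \<phi>_def rook_module_simps)
    show "\<forall>f\<in>with_last n k. \<phi> (\<lambda>S. if n \<in> S then 0 else f (insert n S)) = f"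
      by (auto simp: \<phi>_def with_last_def insert_absorb)
    show "\<phi> ` carrier (rook_module (n - 1) (k - 1)) \<subseteq> with_last n k"
      using \<phi>_in by blast
    show "(\<lambda>f S. if n \<in> S then 0 else f (insert n S)) ` with_last n k
        \<subseteq> carrier (rook_module (n - 1) (k - 1))"
      using subsets_of_card_with_last[OF n k] by (auto simp: with_last_def rook_module_simps)
  qed
  moreover have "\<phi> (act (rook_module (n - 1) (k - 1)) d g) = act (restricted_rook_module n k) d (\<phi> g)"
    if d: "d \<in> carrier (planar_rook_monoid (n - 1))"
      and g: "g \<in> carrier (rook_module (n - 1) (k - 1))" for d g
  proof
    fix T
    have rook: "rook_diagram (n - 1) d"
      using d by (simp add: planar_rook_monoid_def)
    have \<phi>c: "\<phi> g \<in> carrier (rook_module n k)"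
      using \<phi>_in[OF g] by (simp add: with_last_def)
    have nd: "n \<notin> d `` S" for S
      using planar_rook_bounds(2)[OF d, of S] n by auto
    show "\<phi> (act (rook_module (n - 1) (k - 1)) d g) T = act (restricted_rook_module n k) d (\<phi> g) T"
    proof (cases "n \<in> T")
      case True
      then have T: "T = insert n (T - {n})" by auto
      have "act (restricted_rook_module n k) d (\<phi> g) T =
          (if T - {n} \<subseteq> Domain d then g (d `` (T - {n})) else 0)"
        using restricted_act_apply(2)[OF n d \<phi>c, of "T - {n}"] nd[of "T - {n}"] True
        by (simp add: insert_absorb) (simp add: \<phi>_def)
      then show ?thesis
        unfolding \<phi>_def act_rook_module_apply[OF rook g] using True by simp
    next
      case False
      then show ?thesis
        using restricted_act_apply(1)[OF n d \<phi>c False] nd by (simp add: \<phi>_def)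
    qed
  qed
  ultimately show ?thesis
    unfolding module_isomorphic_def
    by (intro exI[of _ \<phi>]) (auto simp: restrict_along_simps rook_module_simps \<phi>_def)
qed


section \<open>Summands detected by idempotents\<close>

lemma Id_on_planar_rook:
  assumes "A \<subseteq> {1..m}"
  shows "Id_on A \<in> carrier (planar_rook_monoid m)"
  using assms unfolding planar_rook_iff rook_diagram_def by auto

text \<open>
  The idempotents \<open>Id_on A\<close> act on coordinates by
  the condition \<open>B \<subseteq> A\<close> in \<open>V\<^sup>n\<^sup>-\<^sup>1\<^sub>l\<close>, but by \<open>T - {n} \<subseteq> A\<close> in the restriction of \<open>V\<^sup>n\<^sub>k\<close>, where
  \<open>n\<close> is always carried along. The two cases of the conclusion are whether \<open>n\<close> lies in \<open>T\<close>.
\<close>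

lemma rook_module_summand_imp:
  assumes n: "1 \<le> n" and l: "l \<le> n - 1"
    and summand: "is_summand (planar_rook_monoid (n - 1)) complex_field (rook_module (n - 1) l)
      (restricted_rook_module n k)"
  shows "k = l \<or> k = l + 1"
proof -
  let ?V = "restricted_rook_module n k" and ?W = "rook_module (n - 1) l"
  obtain U \<psi> where U: "invariant_submodule (planar_rook_monoid (n - 1)) complex_field ?V U"
    and bij: "bij_betw \<psi> (carrier ?W) U"
    and smult: "\<forall>a\<in>carrier complex_field. \<forall>x\<in>carrier ?W. \<psi> (a \<odot>\<^bsub>?W\<^esub> x) = a \<odot>\<^bsub>?V\<^esub> \<psi> x"
    and act: "\<forall>d\<in>carrier (planar_rook_monoid (n - 1)). \<forall>x\<in>carrier ?W.
      \<psi> (act ?W d x) = act ?V d (\<psi> x)"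
    using summand unfolding is_summand_def module_isomorphic_def by auto
  interpret V: monoid_module "planar_rook_monoid (n - 1)" complex_field ?V
    using n by (rule monoid_module_restricted_rook_module)
  have "U \<subseteq> carrier ?V"
    using U V.V.submoduleE(1) by (simp add: invariant_submodule_def)
  then have \<psi>c: "\<psi> x \<in> carrier (rook_module n k)" if "x \<in> carrier ?W" for x
    using bij that by (auto simp: bij_betw_def restrict_along_simps)
  have zero: "(\<lambda>_. 0) \<in> carrier ?W"
    by (simp add: rook_module_simps)
  have \<psi>0: "\<psi> (\<lambda>_. 0) = (\<lambda>_. 0)"
    using smult[rule_format, of 0, OF _ zero]
    by (simp add: complex_field_def restrict_along_simps rook_module_simps)
  define S where "S = {1..l}"
  have S: "S \<in> subsets_of_card (n - 1) l" "S \<subseteq> {1..n - 1}"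
    using l by (auto simp: S_def subsets_of_card_def)
  define v where "v = basis_vector S"
  have v: "v \<in> carrier ?W" "v \<noteq> (\<lambda>_. 0)"
    using S by (auto simp: v_def basis_vector_def rook_module_simps fun_eq_iff)
  have "\<psi> v \<noteq> (\<lambda>_. 0)"
    using bij v zero \<psi>0 by (metis bij_betw_def inj_onD)
  then obtain T where T: "\<psi> v T \<noteq> 0" by blast
  have Tc: "T \<in> subsets_of_card n k"
    using \<psi>c[OF v(1)] T by (auto simp: rook_module_simps)
  have act_Id: "\<psi> (\<lambda>B. if B \<subseteq> A then v B else 0) T = (if T - {n} \<subseteq> A then \<psi> v T else 0)"
    if A: "A \<subseteq> {1..n - 1}" for A
  proof -
    have dA: "Id_on A \<in> carrier (planar_rook_monoid (n - 1))"
      using A by (rule Id_on_planar_rook)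
    have "act ?W (Id_on A) v = (\<lambda>B. if B \<subseteq> A then v B else 0)"
    proof -
      have "rook_diagram (n - 1) (Id_on A)"
        using dA by (simp add: planar_rook_monoid_def)
      from act_rook_module_apply[OF this v(1)] show ?thesis
        by (auto simp: Int_absorb1)
    qed
    moreover have "act ?V (Id_on A) (\<psi> v) T = (if T - {n} \<subseteq> A then \<psi> v T else 0)"
      using restricted_act_apply(1)[OF n dA \<psi>c[OF v(1)], of "T - {n}"]
        restricted_act_apply(2)[OF n dA \<psi>c[OF v(1)], of "T - {n}"]
      by (cases "n \<in> T") (auto simp: insert_absorb Int_absorb1)
    ultimately show ?thesis
      using bspec[OF bspec[OF act dA] v(1)] by simp
  qed
  \<comment> \<open>\<open>A = S\<close> fixes \<open>v\<close>, hence fixes its image, whose coordinate at \<open>T\<close> is nonzero.\<close>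
  have "T - {n} \<subseteq> S"
  proof (rule ccontr)
    assume "\<not> T - {n} \<subseteq> S"
    moreover have "(\<lambda>B. if B \<subseteq> S then v B else 0) = v"
      by (auto simp: v_def basis_vector_def)
    ultimately show False
      using act_Id[OF S(2)] T by simp
  qed
  \<comment> \<open>\<open>A = T - {n}\<close> keeps the coordinate of the image at \<open>T\<close>, so it cannot kill \<open>v\<close>.\<close>
  moreover have "S \<subseteq> T - {n}"
  proof (rule ccontr)
    assume "\<not> S \<subseteq> T - {n}"
    then have "(\<lambda>B. if B \<subseteq> T - {n} then v B else 0) = (\<lambda>_. 0)"
      by (intro ext) (auto simp: v_def basis_vector_def)
    moreover have "T - {n} \<subseteq> {1..n - 1}"
      using Tc by (fastforce simp: subsets_of_card_def)
    ultimately show False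
      using act_Id[of "T - {n}"] \<psi>0 T by simp
  qed
  ultimately have TS: "T - {n} = S" by blast
  have "card T = k" "card S = l"
    using Tc by (simp_all add: subsets_of_card_def S_def)
  moreover have "card T = Suc (card S)" if "n \<in> T"
  proof -
    have "finite T"
      using Tc unfolding subsets_of_card_def by (auto intro: finite_subset)
    then show ?thesis
      using card.remove[OF _ that] TS by simp
  qed
  moreover have "T = S" if "n \<notin> T"
    using TS that by simp
  ultimately show ?thesis
    by (cases "n \<in> T") simp_all
qed


section \<open>The branching rule\<close>

theorem mainTheorem3:
  fixes n k :: nat
  assumes "1 \<le> n" and "k \<le> n"
  shows
    "(0 < k \<and> k < n \<longrightarrow>
        module_isomorphic (planar_rook_monoid (n - 1)) complex_field
          (restricted_rook_module n k)
          (direct_sum (rook_module (n - 1) (k - 1)) (rook_module (n - 1) k))) \<and>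
     (k = 0 \<longrightarrow>
        module_isomorphic (planar_rook_monoid (n - 1)) complex_field
          (restricted_rook_module n k) (rook_module (n - 1) k)) \<and>
     (k = n \<longrightarrow>
        module_isomorphic (planar_rook_monoid (n - 1)) complex_field
          (restricted_rook_module n k) (rook_module (n - 1) (k - 1))) \<and>
     (\<forall>l \<le> n - 1. ((n, k), (n - 1, l)) \<in> bratteli_edges \<longleftrightarrow> int l \<in> {int k - 1, int k})"
proof (intro conjI allI impI)
  note n = assms(1)
  let ?V = "restricted_rook_module n k"
  note split = invariant_with_last[OF n, of k] invariant_without_last[OF n, of k]
    with_last_Int_without_last[of n k] with_last_add_without_last[of n k]
  note W = monoid_module_rook_module
  {
    assume "0 < k \<and> k < n"
    then have "1 \<le> k" by simp
    from direct_sum_isomorphic_internal[OF monoid_module_restricted_rook_module[OF n] split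
        rook_module_iso_with_last[OF n this] rook_module_iso_without_last[OF n]]
    show "module_isomorphic (planar_rook_monoid (n - 1)) complex_field ?V
        (direct_sum (rook_module (n - 1) (k - 1)) (rook_module (n - 1) k))"
      by (rule module_isomorphic_sym[OF monoid_module_direct_sum[OF W W]])
  next
    assume k: "k = 0"
    have notin: "T \<notin> subsets_of_card n k" if "n \<in> T" for T
      using that k finite_subset[of T "{1..n}"] by (auto simp: subsets_of_card_def card_eq_0_iff)
    have "f \<in> without_last n k" if f: "f \<in> carrier ?V" for f
    proof -
      have "f T = 0" if "n \<in> T" for T
        using f notin[OF that] by (simp add: restrict_along_simps rook_module_simps)
      with f show ?thesis by (simp add: without_last_def restrict_along_simps)
    qed
    then have "without_last n k = carrier ?V"
      by (auto simp: without_last_def restrict_along_simps)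
    then have "?V\<lparr>carrier := without_last n k\<rparr> = ?V" by simp
    then have "module_isomorphic (planar_rook_monoid (n - 1)) complex_field
        (rook_module (n - 1) k) ?V"
      using rook_module_iso_without_last[OF n, of k] by simp
    then show "module_isomorphic (planar_rook_monoid (n - 1)) complex_field ?V
        (rook_module (n - 1) k)"
      by (rule module_isomorphic_sym[OF W])
  next
    assume k: "k = n"
    have notin: "T \<notin> subsets_of_card n k" if "n \<notin> T" for T
    proof
      assume "T \<in> subsets_of_card n k"
      then have "T = {1..n}"
        using k by (intro card_subset_eq) (auto simp: subsets_of_card_def)
      with that n show False by simp
    qed
    have "f \<in> with_last n k" if f: "f \<in> carrier ?V" for f
    proof -
      have "f T = 0" if "n \<notin> T" for T
        using f notin[OF that] by (simp add: restrict_along_simps rook_module_simps)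
      with f show ?thesis by (simp add: with_last_def restrict_along_simps)
    qed
    then have "with_last n k = carrier ?V"
      by (auto simp: with_last_def restrict_along_simps)
    then have "?V\<lparr>carrier := with_last n k\<rparr> = ?V" by simp
    then have "module_isomorphic (planar_rook_monoid (n - 1)) complex_field
        (rook_module (n - 1) (k - 1)) ?V"
      using rook_module_iso_with_last[OF n, of k] n k by simp
    then show "module_isomorphic (planar_rook_monoid (n - 1)) complex_field ?V
        (rook_module (n - 1) (k - 1))"
      by (rule module_isomorphic_sym[OF W])
  next
    fix l assume l: "l \<le> n - 1"
    have edge: "((n, k), (n - 1, l)) \<in> bratteli_edges \<longleftrightarrow>
        is_summand (planar_rook_monoid (n - 1)) complex_field (rook_module (n - 1) l) ?V"
      using assms l by (simp add: bratteli_edges_def bratteli_vertices_def)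
    have "without_last n k <+>\<^bsub>?V\<^esub> with_last n k = carrier ?V"
    proof -
      have "f \<oplus>\<^bsub>?V\<^esub> g = g \<oplus>\<^bsub>?V\<^esub> f" for f g
        by (simp add: restrict_along_simps rook_module_simps add.commute)
      then show ?thesis
        unfolding with_last_add_without_last[symmetric] set_add_def' by blast
    qed
    moreover have "without_last n k \<inter> with_last n k = {\<zero>\<^bsub>?V\<^esub>}"
      using split(3) by (simp add: Int_commute)
    ultimately have "is_summand (planar_rook_monoid (n - 1)) complex_field (rook_module (n - 1) k) ?V"
      unfolding is_summand_def using split(1,2) rook_module_iso_without_last[OF n] by blast
    moreover have "is_summand (planar_rook_monoid (n - 1)) complex_field (rook_module (n - 1) (k - 1)) ?V"
      if "1 \<le> k"
      unfolding is_summand_def using split rook_module_iso_with_last[OF n that] by blast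
    moreover have "int l \<in> {int k - 1, int k} \<longleftrightarrow> l = k \<or> 1 \<le> k \<and> l = k - 1"
      by auto
    ultimately show "((n, k), (n - 1, l)) \<in> bratteli_edges \<longleftrightarrow> int l \<in> {int k - 1, int k}"
      unfolding edge using rook_module_summand_imp[OF n l, of k] by auto
  }
qed

end
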